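(* Let $(X,\mathsf a)$ be an action space. For $u\in X$ and $\tau,c>0$ let $\mathrm U(u;\tau,c):=\{v\in X:\ \mathsf a(\tau,u,v)<c\}$ and $$\mathscr U(u):=\{\mathrm U\subset X:\ \mathrm U\supset \mathrm U(u;\tau,c)\text{ for some }\tau,c>0\}.$$ Then the collections $\mathscr U(u)$, $u\in X$, satisfy the axioms of a Hausdorff neighborhood system, i.e. (1) if $\mathrm U\in\mathscr U(u)$ and $\mathrm U\subset\mathrm U'\subset X$, then $\mathrm U'\in\mathscr U(u)$; (2) every finite intersection of elements of $\mathscr U(u)$ belongs to $\mathscr U(u)$; (3) $u$ belongs to every set of $\mathscr U(u)$; (4) if $\mathrm U\in\mathscr U(u)$ then there is $\mathrm V\in\mathscr U(u)$ such that $\mathrm U\in\mathscr U(v)$ for every $v\in\mathrm V$; (5) if $u_1\ne u_2$ then there exist $\mathrm U_i\in\mathscr U(u_i)$, $i=1,2$, such that $\mathrm U_1\cap\mathrm U_2=\varnothing$. In particular, there exists a unique topology $\mathfrak O$ on $X$ such that for every $u\in X$ the collection $\mathscr U(u)$ is the system of neighborhoods of $u$ in $\mathfrak O$. Moreover, $\mathfrak O$ is a Hausdorff topology satisfying the first countability axiom.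
   Context: An action cost on a set $X$ is a function $\mathsf a:(0,+\infty)\times X\times X\to[0,+\infty)$ such that for all $\tau,\tau_1,\tau_2>0$ and $u_1,u_2,u_3\in X$: (i) $\mathsf a(\tau,u_1,u_2)=0$ if and only if $u_1=u_2$; (ii) $\mathsf a(\tau,u_1,u_2)=\mathsf a(\tau,u_2,u_1)$; (iii) $\mathsf a(\tau_1+\tau_2,u_1,u_3)\le \mathsf a(\tau_1,u_1,u_2)+\mathsf a(\tau_2,u_2,u_3)$. The pair $(X,\mathsf a)$ is called an action space. *)

theory Defs
  imports "HOL-Analysis.Analysis"
begin

text \<open>Only the values \<open>a t u v\<close> with \<open>t > 0\<close> and \<open>u, v \<in> X\<close> are meaningful.\<close>

locale action_space =
  fixes X :: "'a set" and a :: "real \<Rightarrow> 'a \<Rightarrow> 'a \<Rightarrow> real"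
  assumes nonneg: "\<lbrakk>t > 0; u \<in> X; v \<in> X\<rbrakk> \<Longrightarrow> a t u v \<ge> 0"
    and eq_0_iff: "\<lbrakk>t > 0; u \<in> X; v \<in> X\<rbrakk> \<Longrightarrow> a t u v = 0 \<longleftrightarrow> u = v"
    and sym: "\<lbrakk>t > 0; u \<in> X; v \<in> X\<rbrakk> \<Longrightarrow> a t u v = a t v u"
    and triangle: "\<lbrakk>t1 > 0; t2 > 0; u1 \<in> X; u2 \<in> X; u3 \<in> X\<rbrakk>
      \<Longrightarrow> a (t1 + t2) u1 u3 \<le> a t1 u1 u2 + a t2 u2 u3"

definition action_ball ::
    "'a set \<Rightarrow> (real \<Rightarrow> 'a \<Rightarrow> 'a \<Rightarrow> real) \<Rightarrow> 'a \<Rightarrow> real \<Rightarrow> real \<Rightarrow> 'a set"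
  where "action_ball X a u t c = {v \<in> X. a t u v < c}"

definition action_nbhds ::
    "'a set \<Rightarrow> (real \<Rightarrow> 'a \<Rightarrow> 'a \<Rightarrow> real) \<Rightarrow> 'a \<Rightarrow> 'a set set"
  where "action_nbhds X a u = {U. U \<subseteq> X \<and> (\<exists>t>0. \<exists>c>0. action_ball X a u t c \<subseteq> U)}"

text \<open>Neighborhoods are not required to be open.\<close>

definition nbhds_of :: "'a topology \<Rightarrow> 'a \<Rightarrow> 'a set set"
  where "nbhds_of T u = {U. U \<subseteq> topspace T \<and> (\<exists>W. openin T W \<and> u \<in> W \<and> W \<subseteq> U)}"

text \<open>The finite intersections in the second axiom include the empty one, which is \<open>X\<close>;
  hence the factor \<open>X\<close>, as \<open>\<Inter>{}\<close> is the whole type.\<close>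

definition Hausdorff_nbhd_system :: "'a set \<Rightarrow> ('a \<Rightarrow> 'a set set) \<Rightarrow> bool"
  where "Hausdorff_nbhd_system X N \<longleftrightarrow>
    (\<forall>u\<in>X. \<forall>U U'. U \<in> N u \<and> U \<subseteq> U' \<and> U' \<subseteq> X \<longrightarrow> U' \<in> N u) \<and>
    (\<forall>u\<in>X. \<forall>F. finite F \<and> F \<subseteq> N u \<longrightarrow> X \<inter> \<Inter>F \<in> N u) \<and>
    (\<forall>u\<in>X. \<forall>U\<in>N u. u \<in> U) \<and>
    (\<forall>u\<in>X. \<forall>U\<in>N u. \<exists>V\<in>N u. \<forall>v\<in>V. U \<in> N v) \<and>
    (\<forall>u1\<in>X. \<forall>u2\<in>X. u1 \<noteq> u2 \<longrightarrow> (\<exists>U1\<in>N u1. \<exists>U2\<in>N u2. U1 \<inter> U2 = {}))"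

definition nbhd_topology :: "'a set \<Rightarrow> ('a \<Rightarrow> 'a set set) \<Rightarrow> 'a topology \<Rightarrow> bool"
  where "nbhd_topology X N T \<longleftrightarrow> topspace T = X \<and> (\<forall>u\<in>X. nbhds_of T u = N u)"

end

theory Submission
  imports Defs
begin

text \<open>
  Inserting a waiting step at a point, which costs nothing, into the triangle inequality shows that
  \<open>a t u v\<close> is nonincreasing in \<open>t\<close> (\<open>cost_antimono_time\<close>). So the balls shrink when time and cost both
  shrink, and the balls \<open>action_ball X a u r r\<close> with a single radius \<open>r\<close> for time and cost form a
  neighborhood base at \<open>u\<close>; the radii \<open>1 / (n + 1)\<close> already give a countable one. The rest is as in
  a metric space: the triangle inequality adds times and costs simultaneously, so one may halve
  both, and this gives the fourth axiom and the separation axiom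
  (\<open>action_ball_halves_subset\<close>, \<open>action_nbhds_separate\<close>).

  The passage from neighborhoods to a topology is independent of costs. In any topology with
  the prescribed neighborhoods, a set is open exactly if it is a neighborhood of each of its points;
  this determines the topology (\<open>nbhd_topology_openin_iff\<close>). Conversely, for a system that satisfies
  the axioms the sets with this property form a topology, and the points of which \<open>U\<close> is a neighborhood
  form an open set inside \<open>U\<close>, so that the topology has the right neighborhoods
  (\<open>nbhd_topology_exists\<close>).
\<close>

section \<open>From neighborhood systems to topologies\<close>

lemma Hausdorff_nbhd_systemD:
  assumes "Hausdorff_nbhd_system X N" and "u \<in> X"
  shows nbhd_superset: "\<lbrakk>U \<in> N u; U \<subseteq> U'; U' \<subseteq> X\<rbrakk> \<Longrightarrow> U' \<in> N u"
    and nbhd_finite_Inter: "\<lbrakk>finite F; F \<subseteq> N u\<rbrakk> \<Longrightarrow> X \<inter> \<Inter>F \<in> N u"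
    and nbhd_center: "U \<in> N u \<Longrightarrow> u \<in> U"
    and nbhd_refine: "U \<in> N u \<Longrightarrow> \<exists>V\<in>N u. \<forall>v\<in>V. U \<in> N v"
    and nbhd_separate: "\<lbrakk>u' \<in> X; u \<noteq> u'\<rbrakk> \<Longrightarrow> \<exists>U\<in>N u. \<exists>U'\<in>N u'. U \<inter> U' = {}"
proof -
  note sys = assms(1)[unfolded Hausdorff_nbhd_system_def]
  show "\<lbrakk>U \<in> N u; U \<subseteq> U'; U' \<subseteq> X\<rbrakk> \<Longrightarrow> U' \<in> N u"
    using sys[THEN conjunct1] assms(2) by blast
  show "\<lbrakk>finite F; F \<subseteq> N u\<rbrakk> \<Longrightarrow> X \<inter> \<Inter>F \<in> N u"
    using sys[THEN conjunct2, THEN conjunct1] assms(2) by simp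
  show "U \<in> N u \<Longrightarrow> u \<in> U"
    using sys[THEN conjunct2, THEN conjunct2, THEN conjunct1] assms(2) by simp
  show "U \<in> N u \<Longrightarrow> \<exists>V\<in>N u. \<forall>v\<in>V. U \<in> N v"
    using sys[THEN conjunct2, THEN conjunct2, THEN conjunct2, THEN conjunct1] assms(2) by simp
  show "\<lbrakk>u' \<in> X; u \<noteq> u'\<rbrakk> \<Longrightarrow> \<exists>U\<in>N u. \<exists>U'\<in>N u'. U \<inter> U' = {}"
    using sys[THEN conjunct2, THEN conjunct2, THEN conjunct2, THEN conjunct2] assms(2) by simp
qed

lemma nbhd_topology_openin_iff:
  assumes "nbhd_topology X N T"
  shows "openin T W \<longleftrightarrow> W \<subseteq> X \<and> (\<forall>u\<in>W. W \<in> N u)"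
proof -
  have X: "topspace T = X" and N: "\<And>u. u \<in> X \<Longrightarrow> N u = nbhds_of T u"
    using assms by (auto simp: nbhd_topology_def)
  show ?thesis
  proof
    assume W: "openin T W"
    then have "W \<subseteq> X"
      using openin_subset X by blast
    with W N X show "W \<subseteq> X \<and> (\<forall>u\<in>W. W \<in> N u)"
      unfolding nbhds_of_def by blast
  next
    assume W: "W \<subseteq> X \<and> (\<forall>u\<in>W. W \<in> N u)"
    have "\<exists>V. openin T V \<and> u \<in> V \<and> V \<subseteq> W" if "u \<in> W" for u
    proof -
      have "W \<in> nbhds_of T u"
        using W N that by blast
      then show ?thesis
        by (simp add: nbhds_of_def)
    qed
    then show "openin T W"
      using openin_subopen by metis
  qed
qed

lemma nbhd_topology_unique:
  assumes "nbhd_topology X N S" and "nbhd_topology X N T"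
  shows "S = T"
  using assms by (simp add: topology_eq nbhd_topology_openin_iff)

lemma nbhd_topology_exists:
  assumes sys: "Hausdorff_nbhd_system X N"
    and sub: "\<And>u U. \<lbrakk>u \<in> X; U \<in> N u\<rbrakk> \<Longrightarrow> U \<subseteq> X"
  shows "\<exists>T. nbhd_topology X N T"
proof -
  define P where "P = (\<lambda>W. W \<subseteq> X \<and> (\<forall>u\<in>W. W \<in> N u))"
  have "P (S \<inter> T)" if "P S" "P T" for S T
  proof -
    have "S \<inter> T \<in> N u" if u: "u \<in> S \<inter> T" for u
    proof -
      have "u \<in> X" "{S, T} \<subseteq> N u"
        using \<open>P S\<close> \<open>P T\<close> u by (auto simp: P_def)
      then have "X \<inter> \<Inter>{S, T} \<in> N u"
        by (intro nbhd_finite_Inter[OF sys]) auto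
      moreover have "X \<inter> \<Inter>{S, T} = S \<inter> T"
        using \<open>P S\<close> by (auto simp: P_def)
      ultimately show ?thesis by simp
    qed
    then show ?thesis
      using that by (auto simp: P_def)
  qed
  moreover have "P (\<Union>K)" if K: "\<forall>S\<in>K. P S" for K
  proof -
    have sub_X: "\<Union>K \<subseteq> X"
      using K by (auto simp: P_def)
    have "\<Union>K \<in> N u" if u: "u \<in> \<Union>K" for u
    proof -
      obtain S where "S \<in> K" "u \<in> S"
        using u by blast
      then have "S \<in> N u" "S \<subseteq> \<Union>K" "u \<in> X"
        using K by (auto simp: P_def)
      then show ?thesis
        using nbhd_superset[OF sys] sub_X by blast
    qed
    then show ?thesis
      using sub_X by (auto simp: P_def)
  qed
  ultimately have "istopology P"
    by (simp add: istopology_def)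
  then have open_iff: "openin (topology P) W \<longleftrightarrow> P W" for W
    by simp
  have "P X"
    using nbhd_finite_Inter[OF sys, of _ "{}"] by (simp add: P_def)
  then have top: "topspace (topology P) = X"
    unfolding topspace_def open_iff by (auto simp: P_def)
  have "nbhds_of (topology P) u = N u" if u: "u \<in> X" for u
  proof (intro equalityI subsetI)
    fix U assume "U \<in> nbhds_of (topology P) u"
    then obtain W where "U \<subseteq> X" "P W" "u \<in> W" "W \<subseteq> U"
      by (auto simp: nbhds_of_def open_iff top)
    then show "U \<in> N u"
      using nbhd_superset[OF sys u, of W U] by (auto simp: P_def)
  next
    fix U assume U: "U \<in> N u"
    \<comment> \<open>The largest candidate for an open set inside \<open>U\<close>; that it is a neighborhood of each of
      its points is the content of the fourth axiom.\<close>
    define W where "W = {v \<in> X. U \<in> N v}"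
    have "W \<in> N v" if "v \<in> W" for v
    proof -
      have v: "v \<in> X" "U \<in> N v"
        using that by (auto simp: W_def)
      then obtain V where V: "V \<in> N v" "\<forall>w\<in>V. U \<in> N w"
        using nbhd_refine[OF sys] by blast
      then have "V \<subseteq> W"
        using sub[OF v(1) V(1)] by (auto simp: W_def)
      then show ?thesis
        using nbhd_superset[OF sys v(1) V(1)] by (auto simp: W_def)
    qed
    then have "P W"
      by (auto simp: P_def W_def)
    moreover have "u \<in> W" "W \<subseteq> U"
      using u U nbhd_center[OF sys] by (auto simp: W_def)
    ultimately show "U \<in> nbhds_of (topology P) u"
      using sub[OF u U] by (auto simp: nbhds_of_def open_iff top)
  qed
  then show ?thesis
    using top by (auto simp: nbhd_topology_def)
qed

lemma nbhd_topology_nbhdE: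
  assumes "nbhd_topology X N T" and "u \<in> X" and "U \<in> N u"
  obtains W where "openin T W" "u \<in> W" "W \<subseteq> U"
proof -
  have "U \<in> nbhds_of T u"
    using assms by (simp add: nbhd_topology_def)
  then show thesis
    using that by (auto simp: nbhds_of_def)
qed

lemma nbhd_topology_Hausdorff_space:
  assumes sys: "Hausdorff_nbhd_system X N" and T: "nbhd_topology X N T"
  shows "Hausdorff_space T"
  unfolding Hausdorff_space_def
proof (intro allI impI)
  fix u v assume "u \<in> topspace T \<and> v \<in> topspace T \<and> u \<noteq> v"
  then have uv: "u \<in> X" "v \<in> X" "u \<noteq> v"
    using T by (auto simp: nbhd_topology_def)
  then obtain U V where UV: "U \<in> N u" "V \<in> N v" "U \<inter> V = {}"
    using nbhd_separate[OF sys] by blast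
  obtain U' where "openin T U'" "u \<in> U'" "U' \<subseteq> U"
    using nbhd_topology_nbhdE[OF T uv(1) UV(1)] .
  moreover obtain V' where "openin T V'" "v \<in> V'" "V' \<subseteq> V"
    using nbhd_topology_nbhdE[OF T uv(2) UV(2)] .
  ultimately show "\<exists>U V. openin T U \<and> openin T V \<and> u \<in> U \<and> v \<in> V \<and> disjnt U V"
    using UV(3) unfolding disjnt_def by blast
qed

text \<open>The members of the countable bases need not be open; their interiors form the countable
  bases of open sets.\<close>

lemma nbhd_topology_first_countable:
  assumes T: "nbhd_topology X N T"
    and base: "\<And>u. u \<in> X \<Longrightarrow> \<exists>B. countable B \<and> B \<subseteq> N u \<and> (\<forall>U\<in>N u. \<exists>V\<in>B. V \<subseteq> U)"
  shows "first_countable T"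
  unfolding first_countable_def
proof
  fix u assume "u \<in> topspace T"
  then have u: "u \<in> X"
    using T by (simp add: nbhd_topology_def)
  obtain B where B: "countable B" "B \<subseteq> N u" "\<forall>U\<in>N u. \<exists>V\<in>B. V \<subseteq> U"
    using base[OF u] by (elim exE conjE)
  have "\<exists>V\<in>(interior_of) T ` B. u \<in> V \<and> V \<subseteq> W" if "openin T W" "u \<in> W" for W
  proof -
    have "W \<in> N u"
      using that by (simp add: nbhd_topology_openin_iff[OF T])
    then obtain V where V: "V \<in> B" "V \<subseteq> W"
      using B by blast
    have "V \<in> N u"
      using V B by blast
    then obtain O' where "openin T O'" "u \<in> O'" "O' \<subseteq> V"
      by (rule nbhd_topology_nbhdE[OF T u])
    then have "u \<in> T interior_of V"
      using interior_of_maximal[of O' V T] by (simp add: subset_iff)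
    moreover have "T interior_of V \<subseteq> W"
      using V(2) interior_of_subset[of T V] by (rule order_trans[rotated])
    ultimately show ?thesis
      using V(1) by (intro bexI[OF _ imageI]) simp
  qed
  then show "\<exists>\<B>. countable \<B> \<and> (\<forall>V\<in>\<B>. openin T V) \<and>
      (\<forall>U. openin T U \<and> u \<in> U \<longrightarrow> (\<exists>V\<in>\<B>. u \<in> V \<and> V \<subseteq> U))"
    using B(1) by (intro exI[of _ "(interior_of) T ` B"]) simp
qed

section \<open>Balls and neighborhoods in an action space\<close>

context action_space
begin

lemma cost_antimono_time:
  assumes "0 < s" "s \<le> t" "u \<in> X" "v \<in> X"
  shows "a t u v \<le> a s u v"
proof (cases "s = t")
  case False
  \<comment> \<open>Go from \<open>u\<close> to \<open>v\<close> in time \<open>s\<close> and wait at \<open>v\<close> for the remaining time.\<close>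
  have "a (s + (t - s)) u v \<le> a s u v + a (t - s) v v"
    using assms False by (intro triangle) auto
  moreover have "a (t - s) v v = 0"
    using eq_0_iff[of "t - s" v v] assms False by simp
  ultimately show ?thesis by simp
qed simp

lemma action_ball_mono:
  assumes "0 < s" "s \<le> t" "c \<le> d" "u \<in> X"
  shows "action_ball X a u s c \<subseteq> action_ball X a u t d"
  using cost_antimono_time[OF assms(1,2,4)] assms(3)
  by (force simp: action_ball_def)

lemma action_nbhds_iff:
  assumes "u \<in> X"
  shows "U \<in> action_nbhds X a u \<longleftrightarrow> U \<subseteq> X \<and> (\<exists>r>0. action_ball X a u r r \<subseteq> U)"
proof -
  have "action_ball X a u (min t c) (min t c) \<subseteq> action_ball X a u t c"
    if "t > 0" "c > 0" for t c
    using that assms by (intro action_ball_mono) auto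
  then have "\<exists>r>0. action_ball X a u r r \<subseteq> U" if "t > 0" "c > 0" "action_ball X a u t c \<subseteq> U" for t c
    using that by (intro exI[of _ "min t c"]) auto
  then show ?thesis
    unfolding action_nbhds_def by blast
qed

lemma action_ball_nbhd:
  assumes "u \<in> X" "r > 0"
  shows "action_ball X a u r r \<in> action_nbhds X a u"
  using assms by (auto simp: action_nbhds_iff action_ball_def)

lemma action_ball_halves_subset:
  assumes "r > 0" "u \<in> X" "v \<in> action_ball X a u (r/2) (r/2)"
  shows "action_ball X a v (r/2) (r/2) \<subseteq> action_ball X a u r r"
proof
  fix w assume w: "w \<in> action_ball X a v (r/2) (r/2)"
  have "a (r/2 + r/2) u w \<le> a (r/2) u v + a (r/2) v w"
    using assms w by (intro triangle) (auto simp: action_ball_def)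
  then show "w \<in> action_ball X a u r r"
    using assms w by (auto simp: action_ball_def)
qed

lemma action_nbhds_finite_Inter:
  assumes "finite F" "F \<subseteq> action_nbhds X a u" "u \<in> X"
  shows "X \<inter> \<Inter>F \<in> action_nbhds X a u"
  using assms(1,2)
proof induction
  case empty
  show ?case
    using assms(3) action_ball_nbhd[of u 1] by (auto simp: action_nbhds_iff)
next
  case (insert U F)
  then obtain r s where r: "r > 0" "action_ball X a u r r \<subseteq> U"
    and s: "s > 0" "action_ball X a u s s \<subseteq> X \<inter> \<Inter>F"
    using assms(3) by (auto simp: action_nbhds_iff)
  have "action_ball X a u (min r s) (min r s) \<subseteq> action_ball X a u r r"
    "action_ball X a u (min r s) (min r s) \<subseteq> action_ball X a u s s"
    using r s assms(3) by (intro action_ball_mono; simp)+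
  then have "action_ball X a u (min r s) (min r s) \<subseteq> X \<inter> \<Inter>(insert U F)"
    using r s by auto
  then show ?case
    using r s assms(3) by (auto simp: action_nbhds_iff intro!: exI[of _ "min r s"])
qed

text \<open>Points joined at cost \<open>c\<close> in unit time cannot both reach a third point in time \<open>1/2\<close>
  at cost below \<open>c/2\<close>, by symmetry and the triangle inequality.\<close>

lemma action_nbhds_separate:
  assumes "u \<in> X" "v \<in> X" "u \<noteq> v"
  shows "\<exists>U\<in>action_nbhds X a u. \<exists>V\<in>action_nbhds X a v. U \<inter> V = {}"
proof -
  define c where "c = a 1 u v"
  have c: "c > 0"
    using nonneg[of 1 u v] eq_0_iff[of 1 u v] assms by (simp add: c_def)
  have "w \<notin> action_ball X a v (1/2) (c/2)" if w: "w \<in> action_ball X a u (1/2) (c/2)" for w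
  proof -
    have "w \<in> X" "a (1/2) u w < c/2"
      using w by (auto simp: action_ball_def)
    moreover from this have "a (1/2 + 1/2) u v \<le> a (1/2) u w + a (1/2) w v"
      using assms by (intro triangle) auto
    moreover have "a (1/2) w v = a (1/2) v w"
      using sym[of "1/2" w v] assms \<open>w \<in> X\<close> by simp
    ultimately show ?thesis
      by (auto simp: action_ball_def c_def)
  qed
  then have "action_ball X a u (1/2) (c/2) \<inter> action_ball X a v (1/2) (c/2) = {}"
    by blast
  moreover have "action_ball X a x (1/2) (c/2) \<in> action_nbhds X a x" for x
  proof -
    have "action_ball X a x (1/2) (c/2) \<subseteq> X"
      by (auto simp: action_ball_def)
    moreover have "0 < c/2" "(0::real) < 1/2"
      using c by auto
    ultimately show ?thesis
      unfolding action_nbhds_def by blast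
  qed
  ultimately show ?thesis by blast
qed

lemma Hausdorff_nbhd_system_action_nbhds: "Hausdorff_nbhd_system X (action_nbhds X a)"
  unfolding Hausdorff_nbhd_system_def
proof (intro conjI ballI allI impI)
  fix u U U'
  assume "u \<in> X" "U \<in> action_nbhds X a u \<and> U \<subseteq> U' \<and> U' \<subseteq> X"
  then show "U' \<in> action_nbhds X a u"
    by (meson action_nbhds_iff order_trans)
next
  fix u F
  assume "u \<in> X" "finite F \<and> F \<subseteq> action_nbhds X a u"
  then show "X \<inter> \<Inter>F \<in> action_nbhds X a u"
    by (intro action_nbhds_finite_Inter) auto
next
  fix u U
  assume u: "u \<in> X" "U \<in> action_nbhds X a u"
  then obtain r where "r > 0" "action_ball X a u r r \<subseteq> U"
    by (auto simp: action_nbhds_iff)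
  moreover from this have "u \<in> action_ball X a u r r"
    using eq_0_iff[of r u u] u by (simp add: action_ball_def)
  ultimately show "u \<in> U" by blast
next
  fix u U
  assume u: "u \<in> X" and U: "U \<in> action_nbhds X a u"
  then obtain r where r: "r > 0" "action_ball X a u r r \<subseteq> U" "U \<subseteq> X"
    by (auto simp: action_nbhds_iff)
  have "U \<in> action_nbhds X a v" if v: "v \<in> action_ball X a u (r/2) (r/2)" for v
  proof -
    have "action_ball X a v (r/2) (r/2) \<subseteq> U" "v \<in> X" "r/2 > 0"
      using action_ball_halves_subset[OF r(1) u v] r v by (auto simp: action_ball_def)
    then show ?thesis
      using r(3) action_nbhds_iff by blast
  qed
  moreover have "action_ball X a u (r/2) (r/2) \<in> action_nbhds X a u"
    using action_ball_nbhd[OF u, of "r/2"] r by simp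
  ultimately show "\<exists>V\<in>action_nbhds X a u. \<forall>v\<in>V. U \<in> action_nbhds X a v"
    by blast
next
  fix u v
  assume "u \<in> X" "v \<in> X" "u \<noteq> v"
  then show "\<exists>U\<in>action_nbhds X a u. \<exists>V\<in>action_nbhds X a v. U \<inter> V = {}"
    by (rule action_nbhds_separate)
qed

lemma action_nbhds_countable_base:
  assumes u: "u \<in> X"
  shows "\<exists>B. countable B \<and> B \<subseteq> action_nbhds X a u \<and> (\<forall>U\<in>action_nbhds X a u. \<exists>V\<in>B. V \<subseteq> U)"
proof -
  define b where "b n = action_ball X a u (1 / real (Suc n)) (1 / real (Suc n))" for n
  have "range b \<subseteq> action_nbhds X a u"
    using action_ball_nbhd[OF u] by (auto simp: b_def)
  moreover have "\<exists>V\<in>range b. V \<subseteq> U" if U: "U \<in> action_nbhds X a u" for U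
  proof -
    obtain r where r: "r > 0" "action_ball X a u r r \<subseteq> U"
      using U u by (auto simp: action_nbhds_iff)
    obtain n where "1 / real (Suc n) < r"
      using nat_approx_posE[OF r(1)] by auto
    then have "b n \<subseteq> action_ball X a u r r"
      unfolding b_def using u by (intro action_ball_mono) auto
    then show ?thesis
      using r(2) by blast
  qed
  ultimately show ?thesis
    by (intro exI[of _ "range b"]) auto
qed

end

section \<open>The topology of an action space\<close>

theorem proposition3p1:
  fixes X :: "'a set" and a :: "real \<Rightarrow> 'a \<Rightarrow> 'a \<Rightarrow> real"
  assumes "action_space X a"
  shows "Hausdorff_nbhd_system X (action_nbhds X a) \<and>
    (\<exists>!T. nbhd_topology X (action_nbhds X a) T) \<and>
    (\<forall>T. nbhd_topology X (action_nbhds X a) T \<longrightarrow> Hausdorff_space T \<and> first_countable T)"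
proof -
  interpret action_space X a by fact
  note sys = Hausdorff_nbhd_system_action_nbhds
  have "\<exists>T. nbhd_topology X (action_nbhds X a) T"
    using nbhd_topology_exists[OF sys] by (simp add: action_nbhds_def)
  then have "\<exists>!T. nbhd_topology X (action_nbhds X a) T"
    using nbhd_topology_unique by blast
  moreover have "Hausdorff_space T \<and> first_countable T"
    if "nbhd_topology X (action_nbhds X a) T" for T
    using nbhd_topology_Hausdorff_space[OF sys that]
      nbhd_topology_first_countable[OF that action_nbhds_countable_base] by blast
  ultimately show ?thesis
    using sys by blast
qed

end
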